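(* Let $\mathbf{A}\in\mathbb{C}^{2^n\times 2^n}$ have a single nonzero entry, in position $(r,c)$, where $r=\sum_{p=0}^{n-1}2^{n-1-p}q_r(p)$ and $c=\sum_{p=0}^{n-1}2^{n-1-p}q_c(p)$ with $q_r(p),q_c(p)\in\{0,1\}$. Then $$\mathbf{A}=\mathbf{A}(r,c)\,\bigotimes_{p=0}^{n-1}\sigma\big(q_r(p),q_c(p)\big),$$ where $$\sigma(q_r(p),q_c(p))=\begin{cases}\sigma_+\sigma_-, & q_r(p)=0,\ q_c(p)=0,\\ \sigma_+, & q_r(p)=0,\ q_c(p)=1,\\ \sigma_-, & q_r(p)=1,\ q_c(p)=0,\\ \sigma_-\sigma_+, & q_r(p)=1,\ q_c(p)=1.\end{cases}$$
   Context: Rows and columns of matrices are indexed from $0$ to $2^n-1$, and $\mathbf{A}(r,c)$ denotes the entry in row $r$ and column $c$. The tensor product is taken in the order $p=0,1,\dots,n-1$ (leftmost factor $p=0$) and is the Kronecker product. Here $\sigma_+=|0\rangle\langle 1|=\begin{bmatrix}0&1\\0&0\end{bmatrix}$, $\sigma_-=|1\rangle\langle 0|=\begin{bmatrix}0&0\\1&0\end{bmatrix}$, $\sigma_+\sigma_-=|0\rangle\langle 0|=\begin{bmatrix}1&0\\0&0\end{bmatrix}$, $\sigma_-\sigma_+=|1\rangle\langle 1|=\begin{bmatrix}0&0\\0&1\end{bmatrix}$. The displayed expression is called the linear combination of non-unitaries (LCNU) decomposition of $\mathbf{A}$ over the Sigma basis $\{\mathbf{I}_2,\sigma_+,\sigma_-,\sigma_+\sigma_-,\sigma_-\sigma_+\}$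 (it has a single term). *)

theory Defs
  imports Complex_Main "Jordan_Normal_Form.Matrix"
begin

definition kron :: "'a :: semiring_1 mat \<Rightarrow> 'a mat \<Rightarrow> 'a mat" where
  "kron A B = mat (dim_row A * dim_row B) (dim_col A * dim_col B)
     (\<lambda>(i, j). A $$ (i div dim_row B, j div dim_col B) * B $$ (i mod dim_row B, j mod dim_col B))"

(* big_kron F n is the iterated product F 0, F 1, ..., F (n - 1), leftmost factor F 0;
   the empty product is the 1 x 1 identity. *)
primrec big_kron :: "(nat \<Rightarrow> 'a :: semiring_1 mat) \<Rightarrow> nat \<Rightarrow> 'a mat" where
  "big_kron F 0 = 1\<^sub>m 1"
| "big_kron F (Suc n) = kron (big_kron F n) (F n)"

definition sigma_plus :: "complex mat" where
  "sigma_plus = mat_of_rows_list 2 [[0, 1], [0, 0]]"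

definition sigma_minus :: "complex mat" where
  "sigma_minus = mat_of_rows_list 2 [[0, 0], [1, 0]]"

(* Only the arguments 0 and 1 are meaningful; the final branch is the case (1, 1). *)
definition sigma :: "nat \<Rightarrow> nat \<Rightarrow> complex mat" where
  "sigma a b =
     (if a = 0 \<and> b = 0 then sigma_plus * sigma_minus
      else if a = 0 \<and> b = 1 then sigma_plus
      else if a = 1 \<and> b = 0 then sigma_minus
      else sigma_minus * sigma_plus)"

lemma sigma_plus_minus: "sigma_plus * sigma_minus = mat_of_rows_list 2 [[1, 0], [0, 0]]"
  by (rule eq_matI)
    (auto simp: sigma_plus_def sigma_minus_def mat_of_rows_list_def scalar_prod_def
      numeral_2_eq_2 less_Suc_eq)

lemma sigma_minus_plus: "sigma_minus * sigma_plus = mat_of_rows_list 2 [[0, 0], [0, 1]]"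
  by (rule eq_matI)
    (auto simp: sigma_plus_def sigma_minus_def mat_of_rows_list_def scalar_prod_def
      numeral_2_eq_2 less_Suc_eq)

end

theory Submission
  imports Defs
begin

text \<open>Each \<open>sigma a b\<close> with binary digits is the 2 x 2 matrix unit with its 1 in
  position (a, b). A Kronecker product of matrix units is again a matrix unit, and its row and
  column indices arise by writing the indices of the factors as successive digits
  (\<open>kron_matrix_unit\<close>). So the whole product is the matrix unit at (r, c)
  (\<open>big_kron_sigma\<close>), and A is its only nonzero entry times that unit.\<close>

definition matrix_unit :: "nat \<Rightarrow> nat \<Rightarrow> nat \<Rightarrow> 'a :: semiring_1 mat" where
  "matrix_unit d r c = mat d d (\<lambda>(i, j). if i = r \<and> j = c then 1 else 0)"

lemma matrix_unit_index [simp]: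
  "i < d \<Longrightarrow> j < d \<Longrightarrow> matrix_unit d r c $$ (i, j) = (if i = r \<and> j = c then 1 else 0)"
  "dim_row (matrix_unit d r c) = d"
  "dim_col (matrix_unit d r c) = d"
  by (simp_all add: matrix_unit_def)

text \<open>Links the quotient and remainder in \<open>kron\<close> to the positional form of the
  index of the product.\<close>

lemma eq_mult_add_iff_div_mod:
  fixes i k r a :: nat
  assumes "a < k"
  shows "i = r * k + a \<longleftrightarrow> i div k = r \<and> i mod k = a"
  using assms div_mult_mod_eq[of i k] by auto

text \<open>An entry of the product is 1 exactly when the quotients of its indices by k are r and c
  and the remainders are a and b; since a and b are below k, this determines the position.\<close>

lemma kron_matrix_unit:
  assumes "a < k" "b < k"
  shows "kron (matrix_unit d r c) (matrix_unit k a b) = matrix_unit (d * k) (r * k + a) (c * k + b)"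
  using assms
  by (intro eq_matI)
    (simp_all add: kron_def less_mult_imp_div_less eq_mult_add_iff_div_mod)

lemma sigma_eq_matrix_unit:
  assumes "a \<in> {0, 1}" "b \<in> {0, 1}"
  shows "sigma a b = matrix_unit 2 a b"
  using assms
  by (intro eq_matI)
    (auto simp: sigma_def sigma_plus_minus sigma_minus_plus sigma_plus_def sigma_minus_def
      mat_of_rows_list_def scalar_prod_def numeral_2_eq_2 less_Suc_eq)

text \<open>Horner's rule: appending a least significant digit doubles the weight of all earlier
  ones.\<close>

lemma binary_value_Suc:
  fixes q :: "nat \<Rightarrow> nat"
  shows "(\<Sum>p<Suc n. 2 ^ (Suc n - 1 - p) * q p) = (\<Sum>p<n. 2 ^ (n - 1 - p) * q p) * 2 + q n"
proof -
  have "2 ^ (Suc n - 1 - p) * q p = 2 ^ (n - 1 - p) * q p * 2" if "p < n" for p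
  proof -
    \<comment> \<open>Subtraction on naturals truncates, hence the bound on p.\<close>
    have "Suc n - 1 - p = Suc (n - 1 - p)" using that by simp
    then show ?thesis by (simp only: power_Suc mult_ac)
  qed
  then have "(\<Sum>p<n. 2 ^ (Suc n - 1 - p) * q p) = (\<Sum>p<n. 2 ^ (n - 1 - p) * q p * 2)"
    by (intro sum.cong) simp_all
  then show ?thesis by (simp add: sum_distrib_right)
qed

text \<open>Induction on n works because \<open>big_kron\<close> adds its new factor on the right,
  where the least significant digit belongs.\<close>

lemma big_kron_sigma:
  assumes "\<And>p. p < n \<Longrightarrow> q p \<in> {0, 1}" "\<And>p. p < n \<Longrightarrow> q' p \<in> {0, 1}"
  shows "big_kron (\<lambda>p. sigma (q p) (q' p)) n =
    matrix_unit (2 ^ n) (\<Sum>p<n. 2 ^ (n - 1 - p) * q p) (\<Sum>p<n. 2 ^ (n - 1 - p) * q' p)"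
  using assms
proof (induction n)
  case 0
  show ?case by (intro eq_matI) simp_all
next
  case (Suc n)
  have digits: "q n \<in> {0, 1}" "q' n \<in> {0, 1}"
    using Suc.prems by blast+
  then have "q n < 2" "q' n < 2" by auto
  moreover have "big_kron (\<lambda>p. sigma (q p) (q' p)) n =
      matrix_unit (2 ^ n) (\<Sum>p<n. 2 ^ (n - 1 - p) * q p) (\<Sum>p<n. 2 ^ (n - 1 - p) * q' p)"
    using Suc.prems by (intro Suc.IH) simp_all
  ultimately show ?case
    \<comment> \<open>\<open>power_Suc2\<close> gives the dimension as \<open>2 ^ n * 2\<close>, the
      shape \<open>d * k\<close> of \<open>kron_matrix_unit\<close>.\<close>
    unfolding big_kron.simps binary_value_Suc power_Suc2
    by (simp only: sigma_eq_matrix_unit[OF digits] kron_matrix_unit)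
qed

theorem theorem3:
  fixes n r c :: nat and A :: "complex mat" and q\<^sub>r q\<^sub>c :: "nat \<Rightarrow> nat"
  assumes "A \<in> carrier_mat (2 ^ n) (2 ^ n)"
    and "\<And>p. p < n \<Longrightarrow> q\<^sub>r p \<in> {0, 1}"
    and "\<And>p. p < n \<Longrightarrow> q\<^sub>c p \<in> {0, 1}"
    and "r = (\<Sum>p<n. 2 ^ (n - 1 - p) * q\<^sub>r p)"
    and "c = (\<Sum>p<n. 2 ^ (n - 1 - p) * q\<^sub>c p)"
    and "A $$ (r, c) \<noteq> 0"
    and "\<And>i j. i < 2 ^ n \<Longrightarrow> j < 2 ^ n \<Longrightarrow> (i, j) \<noteq> (r, c) \<Longrightarrow> A $$ (i, j) = 0"
  shows "A = A $$ (r, c) \<cdot>\<^sub>m big_kron (\<lambda>p. sigma (q\<^sub>r p) (q\<^sub>c p)) n"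
proof -
  have "big_kron (\<lambda>p. sigma (q\<^sub>r p) (q\<^sub>c p)) n = matrix_unit (2 ^ n) r c"
    unfolding assms(4,5) using assms(2,3) by (rule big_kron_sigma)
  moreover have "A = A $$ (r, c) \<cdot>\<^sub>m matrix_unit (2 ^ n) r c"
    using assms(1,7) by (intro eq_matI) auto
  ultimately show ?thesis by simp
qed

end
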